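(* Let $\mathcal T$ be a basic theory and $\zeta\Rightarrow_r\eta$ a graded implication. If there is a forest proof of $\zeta\Rightarrow_r\eta$ from $\mathcal T$, then $\mathcal T\vdash\zeta\Rightarrow_r\eta$ in the calculus $\mathbf{LAE}$.
   Context: Boolean formulas are built from countably many variables and $\bot,\top$ via $\wedge,\vee,\neg$; $\alpha,\beta$ are Boolean equivalent if $\alpha\to\beta$ and $\beta\to\alpha$ are classical tautologies. A graded implication is $\alpha\Rightarrow_d\beta$, $d\in\mathbb R^+=[0,\infty)$. The calculus $\mathbf{LAE}$ has rules ($c,d\in\mathbb R^+$): (R1) $\alpha\Rightarrow_0\beta$ whenever $\alpha\to\beta$ is a classical tautology; (R2) from $\alpha\Rightarrow_0\beta$ infer $\alpha\wedge\gamma\Rightarrow_0\beta\wedge\gamma$; (R3) from $\alpha\Rightarrow_c\beta$ infer $\alpha\Rightarrow_d\beta$ for $d\ge c$; (R4) from $\alpha\Rightarrow_c\bot$ infer $\alpha\Rightarrow_0\bot$; (R5) from $\alpha\Rightarrow_c\gamma$ and $\beta\Rightarrow_c\gamma$ infer $\alpha\vee\beta\Rightarrow_c\gamma$; (R6) from $\alpha\Rightarrow_c\beta$ and $\beta\Rightarrow_d\gamma$ infer $\alpha\Rightarrow_{c+d}\gamma$. $\mathcal T\vdash\Phi$ means there is a finite sequence ending in $\Phi$ each member of which is in $\mathcal T$ or follows from earlier members by a rule. A literal is $\phi$ or $\neg\phi$ for a variable $\phi$; a clause is a finite set of literals, inconsistent if it contains some $\phi$ and $\neg\phi$, consistent otherwise;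 a clause set is a finite set of clauses. For a clause set $B$, $f(B)=\bigvee_{L\in B}\bigwedge L$ (empty conjunction $=\top$, empty disjunction $=\bot$); $B$ is a clause set for $\alpha$ if $f(B)$ is Boolean equivalent to $\alpha$. A basic implication is $\lambda_1\wedge\dots\wedge\lambda_n\Rightarrow_d\bigvee_{i=1}^l\bigwedge_{j=1}^{k_i}\mu_{ij}$ with $n\ge1$, $l\ge0$, $k_i\ge1$, where $\{\lambda_1,\dots,\lambda_n\}$ and all $\{\mu_{i1},\dots,\mu_{ik_i}\}$ are consistent clauses; a basic theory is a set of basic implications. A proof forest is a finite directed forest (each component a rooted tree, edges directed from father to child) with a weight in $\mathbb R^+$ on each edge, each node labelled by a clause or by the symbol $\divideontimes$ (nodes identified with labels; nodes not labelled $\divideontimes$ are proper). A branch is a maximal root-to-leaf path; its length is $0$ if it contains $\divideontimes$ and otherwise the sum of its edge weights; the length of the forest is the maximum length of its branches. A forest proof of $\zeta\Rightarrow_r\eta$ from a basic theory $\mathcal T$ is a proof forest such that: (T1) there is a clause set $B_\zeta$ for $\zeta$ such that each clause of $B_\zeta$ has a root that is a subset of it; (T2) there is a clause set $B_\eta$ for $\eta$ such that every terminal clause includes some clause of $B_\eta$; (T3) the length of the forest is at most $r$; (T4) for every non-terminal clause $L$, all edges from $L$ have the same weight $c$, and one of: (A) $c=0$ and $\mathcal T$ contains a basic implication $\lambda_1\wedge\dots\wedge\lambda_n\Rightarrow_0\bigvee_{i=1}^l\bigwedge_j\mu_{ij}$ with $\{\lambda_1,\dots,\lambda_n\}\subseteq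 L$ such that for each $i$ some child of $L$ is a clause $L'\subseteq\{\mu_{i1},\dots,\mu_{ik_i}\}\cup L$; (B) $c>0$ and $\mathcal T$ contains a basic implication $\lambda_1\wedge\dots\wedge\lambda_n\Rightarrow_c\bigvee_{i=1}^l\bigwedge_j\mu_{ij}$ with $\{\lambda_1,\dots,\lambda_n\}\subseteq L$ such that for each $i$ some child of $L$ is a clause $L'\subseteq\{\mu_{i1},\dots,\mu_{ik_i}\}$; (C) $c=0$, $L$ is inconsistent and $\divideontimes$ is the only child of $L$; (D) $c=0$ and for some variable $\phi$, $L$ has exactly two children, one consisting of $\phi$ together with a subset of $L$, the other of $\neg\phi$ together with a subset of $L$. *)

theory Defs
  imports Complex_Main
begin

datatype form =
    Var nat
  | Bot
  | Top
  | And form form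
  | Or form form
  | Neg form

abbreviation Imp :: "form \<Rightarrow> form \<Rightarrow> form" where
  "Imp \<alpha> \<beta> \<equiv> Or (Neg \<alpha>) \<beta>"

primrec holds :: "(nat \<Rightarrow> bool) \<Rightarrow> form \<Rightarrow> bool" where
  "holds v (Var p) = v p"
| "holds v Bot = False"
| "holds v Top = True"
| "holds v (And \<alpha> \<beta>) = (holds v \<alpha> \<and> holds v \<beta>)"
| "holds v (Or \<alpha> \<beta>) = (holds v \<alpha> \<or> holds v \<beta>)"
| "holds v (Neg \<alpha>) = (\<not> holds v \<alpha>)"

definition tautology :: "form \<Rightarrow> bool" where
  "tautology \<alpha> \<longleftrightarrow> (\<forall>v. holds v \<alpha>)"

definition bool_equiv :: "form \<Rightarrow> form \<Rightarrow> bool" where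
  "bool_equiv \<alpha> \<beta> \<longleftrightarrow> tautology (Imp \<alpha> \<beta>) \<and> tautology (Imp \<beta> \<alpha>)"

fun big_and :: "form list \<Rightarrow> form" where
  "big_and [] = Top"
| "big_and [\<alpha>] = \<alpha>"
| "big_and (\<alpha> # \<beta> # \<gamma>s) = And \<alpha> (big_and (\<beta> # \<gamma>s))"

fun big_or :: "form list \<Rightarrow> form" where
  "big_or [] = Bot"
| "big_or [\<alpha>] = \<alpha>"
| "big_or (\<alpha> # \<beta> # \<gamma>s) = Or \<alpha> (big_or (\<beta> # \<gamma>s))"


section \<open>Graded implications and the calculus LAE\<close>

text \<open>Degrees are reals; the restriction to $[0,\infty)$ is imposed wherever degrees are
  quantified: in the rules, in basic implications and on edge weights.\<close>

datatype gimp = GImp form real form  (\<open>(_ \<Rightarrow>[_] _)\<close> [61, 0, 61] 60)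

text \<open>\<open>lae_step P \<Phi>\<close>: \<open>\<Phi>\<close> follows by a single rule application whose premises all lie in \<open>P\<close>.\<close>

inductive lae_step :: "gimp set \<Rightarrow> gimp \<Rightarrow> bool" for P :: "gimp set" where
  R1: "tautology (Imp \<alpha> \<beta>) \<Longrightarrow> lae_step P (\<alpha> \<Rightarrow>[0] \<beta>)"
| R2: "(\<alpha> \<Rightarrow>[0] \<beta>) \<in> P \<Longrightarrow> lae_step P (And \<alpha> \<gamma> \<Rightarrow>[0] And \<beta> \<gamma>)"
| R3: "0 \<le> c \<Longrightarrow> c \<le> d \<Longrightarrow> (\<alpha> \<Rightarrow>[c] \<beta>) \<in> P \<Longrightarrow> lae_step P (\<alpha> \<Rightarrow>[d] \<beta>)"
| R4: "0 \<le> c \<Longrightarrow> (\<alpha> \<Rightarrow>[c] Bot) \<in> P \<Longrightarrow> lae_step P (\<alpha> \<Rightarrow>[0] Bot)"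
| R5: "0 \<le> c \<Longrightarrow> (\<alpha> \<Rightarrow>[c] \<gamma>) \<in> P \<Longrightarrow> (\<beta> \<Rightarrow>[c] \<gamma>) \<in> P \<Longrightarrow> lae_step P (Or \<alpha> \<beta> \<Rightarrow>[c] \<gamma>)"
| R6: "0 \<le> c \<Longrightarrow> 0 \<le> d \<Longrightarrow> (\<alpha> \<Rightarrow>[c] \<beta>) \<in> P \<Longrightarrow> (\<beta> \<Rightarrow>[d] \<gamma>) \<in> P
       \<Longrightarrow> lae_step P (\<alpha> \<Rightarrow>[c + d] \<gamma>)"

definition lae_proof :: "gimp set \<Rightarrow> gimp list \<Rightarrow> bool" where
  "lae_proof T \<Phi>s \<longleftrightarrow>
     (\<forall>i < length \<Phi>s. \<Phi>s ! i \<in> T \<or> lae_step (set (take i \<Phi>s)) (\<Phi>s ! i))"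

definition lae_proves :: "gimp set \<Rightarrow> gimp \<Rightarrow> bool"  (infix \<open>\<turnstile>\<close> 50) where
  "T \<turnstile> \<Phi> \<longleftrightarrow> (\<exists>\<Phi>s. \<Phi>s \<noteq> [] \<and> last \<Phi>s = \<Phi> \<and> lae_proof T \<Phi>s)"


section \<open>Clauses and basic theories\<close>

datatype lit = PosL nat | NegL nat

primrec lit_form :: "lit \<Rightarrow> form" where
  "lit_form (PosL p) = Var p"
| "lit_form (NegL p) = Neg (Var p)"

type_synonym clause = "lit set"

definition is_clause :: "clause \<Rightarrow> bool" where
  "is_clause L \<longleftrightarrow> finite L"

definition inconsistent :: "clause \<Rightarrow> bool" where
  "inconsistent L \<longleftrightarrow> (\<exists>p. PosL p \<in> L \<and> NegL p \<in> L)"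

definition is_clause_set :: "clause set \<Rightarrow> bool" where
  "is_clause_set B \<longleftrightarrow> finite B \<and> (\<forall>L\<in>B. is_clause L)"

text \<open>A fixed arbitrary enumeration of a finite set; its choice affects the formulas below
  only up to Boolean equivalence.\<close>

definition enum_list :: "'a set \<Rightarrow> 'a list" where
  "enum_list A = (SOME xs. distinct xs \<and> set xs = A)"

definition clause_form :: "clause \<Rightarrow> form" where
  "clause_form L = big_and (map lit_form (enum_list L))"

definition clause_set_form :: "clause set \<Rightarrow> form" where
  "clause_set_form B = big_or (map clause_form (enum_list B))"

definition clause_set_for :: "clause set \<Rightarrow> form \<Rightarrow> bool" where
  "clause_set_for B \<alpha> \<longleftrightarrow> is_clause_set B \<and> bool_equiv (clause_set_form B) \<alpha>"

text \<open>The list \<open>ls\<close> holds the literals $\lambda_1,\dots,\lambda_n$, the list \<open>mss\<close> the lists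
  $\mu_{i1},\dots,\mu_{ik_i}$ for $i=1,\dots,l$.\<close>

definition basic_gimp :: "lit list \<Rightarrow> real \<Rightarrow> lit list list \<Rightarrow> gimp" where
  "basic_gimp ls d mss =
     (big_and (map lit_form ls) \<Rightarrow>[d] big_or (map (\<lambda>ms. big_and (map lit_form ms)) mss))"

definition basic_data :: "lit list \<Rightarrow> real \<Rightarrow> lit list list \<Rightarrow> bool" where
  "basic_data ls d mss \<longleftrightarrow>
     0 \<le> d \<and> ls \<noteq> [] \<and> \<not> inconsistent (set ls) \<and>
     (\<forall>ms\<in>set mss. ms \<noteq> [] \<and> \<not> inconsistent (set ms))"

definition basic_implication :: "gimp \<Rightarrow> bool" where
  "basic_implication \<Phi> \<longleftrightarrow> (\<exists>ls d mss. basic_data ls d mss \<and> \<Phi> = basic_gimp ls d mss)"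

definition basic_theory :: "gimp set \<Rightarrow> bool" where
  "basic_theory T \<longleftrightarrow> (\<forall>\<Phi>\<in>T. basic_implication \<Phi>)"


section \<open>Proof forests\<close>

datatype label = Clause clause | Star

text \<open>A node carries its label and the list of its outgoing edges, each given by its weight and
  the subtree at the child. The order of children and of roots is irrelevant.\<close>

datatype ptree = Node (root_label: label) (edges: "(real \<times> ptree) list")

type_synonym pforest = "ptree list"

abbreviation child_labels :: "(real \<times> ptree) list \<Rightarrow> label list" where
  "child_labels es \<equiv> map (\<lambda>(w, t). root_label t) es"

text \<open>The nodes of a tree, each represented by the subtree hanging from it.\<close>

fun tree_nodes :: "ptree \<Rightarrow> ptree set" where
  "tree_nodes (Node a es) = insert (Node a es) (\<Union>(set (map (\<lambda>(w, t). tree_nodes t) es)))"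

definition forest_nodes :: "pforest \<Rightarrow> ptree set" where
  "forest_nodes F = (\<Union>t\<in>set F. tree_nodes t)"

definition proof_forest :: "pforest \<Rightarrow> bool" where
  "proof_forest F \<longleftrightarrow>
     (\<forall>a es. Node a es \<in> forest_nodes F \<longrightarrow>
        (\<forall>(w, t)\<in>set es. 0 \<le> w) \<and> (\<forall>L. a = Clause L \<longrightarrow> is_clause L))"

text \<open>A branch is given by the labels of its nodes and the weights of its edges, in order.\<close>

fun tree_branches :: "ptree \<Rightarrow> (label list \<times> real list) list" where
  "tree_branches (Node a es) =
     (if es = [] then [([a], [])]
      else concat (map (\<lambda>(w, t). map (\<lambda>(as, ws). (a # as, w # ws)) (tree_branches t)) es))"

definition branch_length :: "label list \<times> real list \<Rightarrow> real" where
  "branch_length b = (if Star \<in> set (fst b) then 0 else sum_list (snd b))"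

text \<open>Branch lengths are nonnegative, so inserting \<open>0\<close> only serves to give the empty forest
  length \<open>0\<close>.\<close>

definition forest_length :: "pforest \<Rightarrow> real" where
  "forest_length F = Max (insert 0 (branch_length ` (\<Union>t\<in>set F. set (tree_branches t))))"

definition case_A :: "gimp set \<Rightarrow> clause \<Rightarrow> real \<Rightarrow> (real \<times> ptree) list \<Rightarrow> bool" where
  "case_A T L c es \<longleftrightarrow> c = 0 \<and>
     (\<exists>ls mss. basic_data ls 0 mss \<and> basic_gimp ls 0 mss \<in> T \<and> set ls \<subseteq> L \<and>
        (\<forall>ms\<in>set mss. \<exists>L'. Clause L' \<in> set (child_labels es) \<and> L' \<subseteq> set ms \<union> L))"

definition case_B :: "gimp set \<Rightarrow> clause \<Rightarrow> real \<Rightarrow> (real \<times> ptree) list \<Rightarrow> bool" where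
  "case_B T L c es \<longleftrightarrow> c > 0 \<and>
     (\<exists>ls mss. basic_data ls c mss \<and> basic_gimp ls c mss \<in> T \<and> set ls \<subseteq> L \<and>
        (\<forall>ms\<in>set mss. \<exists>L'. Clause L' \<in> set (child_labels es) \<and> L' \<subseteq> set ms))"

definition case_C :: "clause \<Rightarrow> real \<Rightarrow> (real \<times> ptree) list \<Rightarrow> bool" where
  "case_C L c es \<longleftrightarrow> c = 0 \<and> inconsistent L \<and> child_labels es = [Star]"

definition case_D :: "clause \<Rightarrow> real \<Rightarrow> (real \<times> ptree) list \<Rightarrow> bool" where
  "case_D L c es \<longleftrightarrow> c = 0 \<and>
     (\<exists>p S1 S2. S1 \<subseteq> L \<and> S2 \<subseteq> L \<and>
        (child_labels es = [Clause (insert (PosL p) S1), Clause (insert (NegL p) S2)] \<or>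
         child_labels es = [Clause (insert (NegL p) S2), Clause (insert (PosL p) S1)]))"

definition forest_proof :: "gimp set \<Rightarrow> form \<Rightarrow> real \<Rightarrow> form \<Rightarrow> pforest \<Rightarrow> bool" where
  "forest_proof T \<zeta> r \<eta> F \<longleftrightarrow>
     proof_forest F \<and>
     (\<exists>B. clause_set_for B \<zeta> \<and> (\<forall>L\<in>B. \<exists>K. Clause K \<in> root_label ` set F \<and> K \<subseteq> L)) \<and>
     (\<exists>B. clause_set_for B \<eta> \<and>
        (\<forall>L. Node (Clause L) [] \<in> forest_nodes F \<longrightarrow> (\<exists>K\<in>B. K \<subseteq> L))) \<and>
     forest_length F \<le> r \<and>
     (\<forall>L es. Node (Clause L) es \<in> forest_nodes F \<and> es \<noteq> [] \<longrightarrow>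
        (\<exists>c. (\<forall>(w, t)\<in>set es. w = c) \<and>
             (case_A T L c es \<or> case_B T L c es \<or> case_C L c es \<or> case_D L c es)))"

end

theory Submission imports Defs begin

text \<open>By induction on the forest, from the leaves upwards, every proper node \<open>L\<close> satisfies one of
  two alternatives: \<open>L \<Rightarrow>[0] \<bottom>\<close> is derivable, or \<open>L \<Rightarrow>[s] \<eta>\<close> is derivable where \<open>s\<close> is the length of
  some branch below \<open>L\<close> that avoids the star symbol. The first alternative is needed because a
  branch running into the star counts as having length \<open>0\<close> whatever its edge weights are; rule R4
  makes this sound when all relevant children of a node are contradictory. If some relevant child
  is not contradictory, it provides a star-free branch to which the weight of the edge is added.\<close>

section \<open>Derivability in LAE\<close>

lemma lae_step_mono:
  assumes "lae_step P \<Phi>" "P \<subseteq> Q"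
  shows "lae_step Q \<Phi>"
  using assms by (induction rule: lae_step.induct) (blast intro: lae_step.intros)+

text \<open>Members of \<open>ys\<close> keep their earlier members and gain those of
  \<open>xs\<close>, and \<open>lae_step\<close> is monotone in the available premises.\<close>

lemma lae_proof_append:
  assumes "lae_proof T xs" "lae_proof T ys"
  shows "lae_proof T (xs @ ys)"
  unfolding lae_proof_def
proof (intro allI impI)
  fix i assume i: "i < length (xs @ ys)"
  show "(xs @ ys) ! i \<in> T \<or> lae_step (set (take i (xs @ ys))) ((xs @ ys) ! i)"
  proof (cases "i < length xs")
    case True
    then show ?thesis using assms(1) by (simp add: lae_proof_def nth_append)
  next
    case False
    let ?j = "i - length xs"
    have "ys ! ?j \<in> T \<or> lae_step (set (take ?j ys)) (ys ! ?j)"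
      using assms(2) i False by (auto simp: lae_proof_def)
    then show ?thesis
      using False by (auto simp: nth_append intro: lae_step_mono)
  qed
qed

text \<open>A rule application needs all its premises in one sequence, so separate derivations are
  merged by concatenation.\<close>

lemma lae_proof_of_finite_set:
  assumes "finite P" "\<And>\<Phi>. \<Phi> \<in> P \<Longrightarrow> T \<turnstile> \<Phi>"
  shows "\<exists>xs. lae_proof T xs \<and> P \<subseteq> set xs"
  using assms
proof (induction P)
  case empty
  show ?case by (intro exI[of _ "[]"]) (simp add: lae_proof_def)
next
  case (insert \<Phi> P)
  then obtain xs where "lae_proof T xs" "P \<subseteq> set xs" by auto
  moreover obtain ys where "lae_proof T ys" "ys \<noteq> []" "last ys = \<Phi>"
    using insert.prems by (auto simp: lae_proves_def)
  moreover from this have "\<Phi> \<in> set ys" by auto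
  ultimately show ?case
    by (intro exI[of _ "xs @ ys"]) (auto intro: lae_proof_append)
qed

text \<open>Carries each rule over to the relation \<open>\<turnstile>\<close>, with
  \<open>P\<close> the set of its premises; sequences need not be mentioned afterwards.\<close>

lemma lae_proves_step:
  assumes "lae_step P \<Phi>" "finite P" "\<And>\<Psi>. \<Psi> \<in> P \<Longrightarrow> T \<turnstile> \<Psi>"
  shows "T \<turnstile> \<Phi>"
proof -
  obtain xs where xs: "lae_proof T xs" "P \<subseteq> set xs"
    using lae_proof_of_finite_set assms(2,3) by blast
  have "lae_step (set xs) \<Phi>" using lae_step_mono assms(1) xs(2) by blast
  then have "lae_proof T (xs @ [\<Phi>])"
    using xs(1) by (auto simp: lae_proof_def nth_append less_Suc_eq)
  then show ?thesis unfolding lae_proves_def by (intro exI[of _ "xs @ [\<Phi>]"]) auto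
qed

lemma lae_proves_axiom: "\<Phi> \<in> T \<Longrightarrow> T \<turnstile> \<Phi>"
  unfolding lae_proves_def lae_proof_def by (intro exI[of _ "[\<Phi>]"]) auto

lemma lae_proves_taut:
  assumes "\<And>v. holds v \<alpha> \<Longrightarrow> holds v \<beta>"
  shows "T \<turnstile> (\<alpha> \<Rightarrow>[0] \<beta>)"
  by (rule lae_proves_step[OF R1[of _ _ "{}"]]) (use assms in \<open>auto simp: tautology_def\<close>)

lemma lae_proves_And:
  assumes "T \<turnstile> (\<alpha> \<Rightarrow>[0] \<beta>)"
  shows "T \<turnstile> (And \<alpha> \<gamma> \<Rightarrow>[0] And \<beta> \<gamma>)"
  by (rule lae_proves_step[OF R2[of \<alpha> \<beta> "{\<alpha> \<Rightarrow>[0] \<beta>}"]]) (use assms in auto)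

lemma lae_proves_weaken:
  assumes "T \<turnstile> (\<alpha> \<Rightarrow>[c] \<beta>)" "0 \<le> c" "c \<le> d"
  shows "T \<turnstile> (\<alpha> \<Rightarrow>[d] \<beta>)"
  by (rule lae_proves_step[OF R3[of c d \<alpha> \<beta> "{\<alpha> \<Rightarrow>[c] \<beta>}"]]) (use assms in auto)

lemma lae_proves_Bot:
  assumes "T \<turnstile> (\<alpha> \<Rightarrow>[c] Bot)" "0 \<le> c"
  shows "T \<turnstile> (\<alpha> \<Rightarrow>[0] Bot)"
  by (rule lae_proves_step[OF R4[of c \<alpha> "{\<alpha> \<Rightarrow>[c] Bot}"]]) (use assms in auto)

lemma lae_proves_Or:
  assumes "T \<turnstile> (\<alpha> \<Rightarrow>[c] \<gamma>)" "T \<turnstile> (\<beta> \<Rightarrow>[c] \<gamma>)" "0 \<le> c"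
  shows "T \<turnstile> (Or \<alpha> \<beta> \<Rightarrow>[c] \<gamma>)"
  by (rule lae_proves_step[OF R5[of c \<alpha> \<gamma> "{\<alpha> \<Rightarrow>[c] \<gamma>, \<beta> \<Rightarrow>[c] \<gamma>}"]]) (use assms in auto)

lemma lae_proves_trans:
  assumes "T \<turnstile> (\<alpha> \<Rightarrow>[c] \<beta>)" "T \<turnstile> (\<beta> \<Rightarrow>[d] \<gamma>)" "0 \<le> c" "0 \<le> d"
  shows "T \<turnstile> (\<alpha> \<Rightarrow>[c + d] \<gamma>)"
  by (rule lae_proves_step[OF R6[of c d \<alpha> \<beta> "{\<alpha> \<Rightarrow>[c] \<beta>, \<beta> \<Rightarrow>[d] \<gamma>}"]]) (use assms in auto)

section \<open>Semantics of clauses\<close>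

lemma holds_big_and [simp]: "holds v (big_and xs) \<longleftrightarrow> (\<forall>x\<in>set xs. holds v x)"
  by (induction xs rule: big_and.induct) auto

lemma holds_big_or [simp]: "holds v (big_or xs) \<longleftrightarrow> (\<exists>x\<in>set xs. holds v x)"
  by (induction xs rule: big_or.induct) auto

lemma set_enum_list [simp]:
  assumes "finite A"
  shows "set (enum_list A) = A"
  using someI_ex[of "\<lambda>xs. distinct xs \<and> set xs = A"] finite_distinct_list[OF assms]
  unfolding enum_list_def by blast

lemma holds_clause_form:
  "finite L \<Longrightarrow> holds v (clause_form L) \<longleftrightarrow> (\<forall>l\<in>L. holds v (lit_form l))"
  by (simp add: clause_form_def)

lemma holds_clause_set_form:
  "finite B \<Longrightarrow> holds v (clause_set_form B) \<longleftrightarrow> (\<exists>L\<in>B. holds v (clause_form L))"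
  by (simp add: clause_set_form_def)

section \<open>The induction along a proof tree\<close>

text \<open>The set \<open>S\<close> of admissible degrees is a parameter, so that one set of rules
  serves branch lengths, shifted branch lengths and the final bound \<open>{..r}\<close>. Since
  \<open>{..r}\<close> also contains negative numbers, \<open>0 \<le> s\<close> is demanded
  separately. If \<open>S\<close> is empty, only refutation remains.\<close>

definition refutes_or_reaches :: "gimp set \<Rightarrow> form \<Rightarrow> real set \<Rightarrow> form \<Rightarrow> bool" where
  "refutes_or_reaches T \<eta> S \<alpha> \<longleftrightarrow>
     T \<turnstile> (\<alpha> \<Rightarrow>[0] Bot) \<or> (\<exists>s\<in>S. 0 \<le> s \<and> T \<turnstile> (\<alpha> \<Rightarrow>[s] \<eta>))"

lemma refutes_or_reaches_mono:
  "refutes_or_reaches T \<eta> S \<alpha> \<Longrightarrow> S \<subseteq> S' \<Longrightarrow> refutes_or_reaches T \<eta> S' \<alpha>"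
  unfolding refutes_or_reaches_def by blast

text \<open>R6 adds the degree \<open>c\<close> in both alternatives; in the refuting one, R4 resets
  it to 0. This is where edge weights above a contradiction disappear.\<close>

lemma refutes_or_reaches_trans:
  assumes "T \<turnstile> (\<alpha> \<Rightarrow>[c] \<beta>)" "0 \<le> c" "refutes_or_reaches T \<eta> S \<beta>"
  shows "refutes_or_reaches T \<eta> ((+) c ` S) \<alpha>"
  using assms(3) unfolding refutes_or_reaches_def
proof
  assume "T \<turnstile> (\<beta> \<Rightarrow>[0] Bot)"
  then have "T \<turnstile> (\<alpha> \<Rightarrow>[c + 0] Bot)" using lae_proves_trans assms by blast
  then have "T \<turnstile> (\<alpha> \<Rightarrow>[0] Bot)" using lae_proves_Bot assms(2) by simp
  then show "T \<turnstile> (\<alpha> \<Rightarrow>[0] Bot) \<or> (\<exists>s\<in>(+) c ` S. 0 \<le> s \<and> T \<turnstile> (\<alpha> \<Rightarrow>[s] \<eta>))" ..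
next
  assume "\<exists>s\<in>S. 0 \<le> s \<and> T \<turnstile> (\<beta> \<Rightarrow>[s] \<eta>)"
  then show "T \<turnstile> (\<alpha> \<Rightarrow>[0] Bot) \<or> (\<exists>s\<in>(+) c ` S. 0 \<le> s \<and> T \<turnstile> (\<alpha> \<Rightarrow>[s] \<eta>))"
    using lae_proves_trans[OF assms(1)] assms(2) by fastforce
qed

lemma refutes_or_reaches_trans0:
  assumes "T \<turnstile> (\<alpha> \<Rightarrow>[0] \<beta>)" "refutes_or_reaches T \<eta> S \<beta>"
  shows "refutes_or_reaches T \<eta> S \<alpha>"
  using refutes_or_reaches_trans[OF assms(1) _ assms(2)] by simp

lemma refutes_or_reaches_taut:
  assumes "\<And>v. holds v \<alpha> \<Longrightarrow> holds v \<beta>" "refutes_or_reaches T \<eta> S \<beta>"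
  shows "refutes_or_reaches T \<eta> S \<alpha>"
  using refutes_or_reaches_trans0 lae_proves_taut assms by metis

lemma lae_proves_Bot_imp:
  assumes "T \<turnstile> (\<alpha> \<Rightarrow>[0] Bot)" "0 \<le> s"
  shows "T \<turnstile> (\<alpha> \<Rightarrow>[s] \<eta>)"
proof -
  have "T \<turnstile> (Bot \<Rightarrow>[0] \<eta>)" by (rule lae_proves_taut) simp
  then have "T \<turnstile> (Bot \<Rightarrow>[s] \<eta>)" using lae_proves_weaken assms(2) by blast
  then show ?thesis using lae_proves_trans[OF assms(1)] assms(2) by fastforce
qed

text \<open>R5 asks for a common degree, so both disjuncts are weakened to the maximum of their
  degrees. The maximum is one of the two, hence no new degree arises and no closure property of
  \<open>S\<close> is required.\<close>

lemma refutes_or_reaches_Or: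
  assumes "refutes_or_reaches T \<eta> S \<alpha>" "refutes_or_reaches T \<eta> S \<beta>"
  shows "refutes_or_reaches T \<eta> S (Or \<alpha> \<beta>)"
proof -
  have comb: "T \<turnstile> (Or \<alpha> \<beta> \<Rightarrow>[max s t] \<eta>)"
    if "0 \<le> s" "T \<turnstile> (\<alpha> \<Rightarrow>[s] \<eta>)" "0 \<le> t" "T \<turnstile> (\<beta> \<Rightarrow>[t] \<eta>)" for s t
    using that lae_proves_weaken[OF that(2,1), of "max s t"]
      lae_proves_weaken[OF that(4,3), of "max s t"]
    by (intro lae_proves_Or) auto
  \<comment> \<open>If just one disjunct is refuted, it reaches \<open>\<eta>\<close> at degree 0.
    This 0 may lie outside \<open>S\<close>, but the other degree is nonnegative and in
    \<open>S\<close>, so the maximum still belongs to \<open>S\<close>.\<close>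
  consider "T \<turnstile> (\<alpha> \<Rightarrow>[0] Bot)" "T \<turnstile> (\<beta> \<Rightarrow>[0] Bot)"
    | s t where "s \<in> S \<or> t \<in> S" "s \<in> S \<or> s = 0" "t \<in> S \<or> t = 0"
        "0 \<le> s" "T \<turnstile> (\<alpha> \<Rightarrow>[s] \<eta>)" "0 \<le> t" "T \<turnstile> (\<beta> \<Rightarrow>[t] \<eta>)"
    using assms lae_proves_Bot_imp[of T _ 0 \<eta>] unfolding refutes_or_reaches_def by auto
  then show ?thesis
  proof cases
    case 1
    then show ?thesis by (simp add: refutes_or_reaches_def lae_proves_Or)
  next
    case 2
    have "max s t \<in> S" using 2(1-4,6) by (auto simp: max_def)
    then show ?thesis using comb[of s t] 2 unfolding refutes_or_reaches_def
      by (meson max.coboundedI1)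
  qed
qed

text \<open>Reasoning by finitely many cases. For an empty list \<open>\<alpha>\<close> is
  unsatisfiable and falls under the refuting alternative; this covers basic implications with empty
  right-hand side.\<close>

lemma refutes_or_reaches_cases:
  assumes "\<And>x. x \<in> set xs \<Longrightarrow> refutes_or_reaches T \<eta> S (f x)"
    and "\<And>v. holds v \<alpha> \<Longrightarrow> \<exists>x\<in>set xs. holds v (f x)"
  shows "refutes_or_reaches T \<eta> S \<alpha>"
proof -
  have "refutes_or_reaches T \<eta> S (big_or (map f xs))"
    using assms(1)
  proof (induction xs)
    case Nil
    have "T \<turnstile> (Bot \<Rightarrow>[0] Bot)" by (rule lae_proves_taut)
    then show ?case by (simp add: refutes_or_reaches_def)
  next
    case (Cons x xs)
    then have "refutes_or_reaches T \<eta> S (Or (f x) (big_or (map f xs)))"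
      by (auto intro: refutes_or_reaches_Or)
    then show ?case by (rule refutes_or_reaches_taut[rotated]) auto
  qed
  then show ?thesis by (rule refutes_or_reaches_taut[rotated]) (use assms(2) in auto)
qed

text \<open>Branches through the star are left out rather than counted as 0. The set is empty if
  every branch meets the star, and the root clause must then be refutable.\<close>

definition star_free_lengths :: "ptree \<Rightarrow> real set" where
  "star_free_lengths t = {sum_list ws | as ws. (as, ws) \<in> set (tree_branches t) \<and> Star \<notin> set as}"

lemma star_free_lengths_child:
  assumes "(w, t) \<in> set es"
  shows "(+) w ` star_free_lengths t \<subseteq> star_free_lengths (Node (Clause L) es)"
proof
  fix x assume "x \<in> (+) w ` star_free_lengths t"
  then obtain as ws where b: "(as, ws) \<in> set (tree_branches t)" "Star \<notin> set as"
    and x: "x = w + sum_list ws"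
    by (auto simp: star_free_lengths_def)
  have "(Clause L # as, w # ws) \<in> set (tree_branches (Node (Clause L) es))"
    using assms b(1) by force
  then show "x \<in> star_free_lengths (Node (Clause L) es)"
    unfolding star_free_lengths_def using b(2) x
    by (intro CollectI exI[of _ "Clause L # as"] exI[of _ "w # ws"]) auto
qed

lemma root_in_tree_nodes: "t \<in> tree_nodes t"
  by (cases t) auto

lemma tree_nodes_child: "(w, t) \<in> set es \<Longrightarrow> tree_nodes t \<subseteq> tree_nodes (Node a es)"
  by force

text \<open>All assumptions speak only of the nodes of \<open>t\<close>, so they are inherited by
  subtrees and the structural induction goes through.\<close>

lemma tree_refutes_or_reaches:
  assumes "\<And>L es. Node (Clause L) es \<in> tree_nodes t \<Longrightarrow> finite L"
    and "\<And>L v. Node (Clause L) [] \<in> tree_nodes t \<Longrightarrow> holds v (clause_form L) \<Longrightarrow> holds v \<eta>"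
    and "\<And>L es. Node (Clause L) es \<in> tree_nodes t \<Longrightarrow> es \<noteq> [] \<Longrightarrow>
        \<exists>c. (\<forall>(w, t)\<in>set es. w = c) \<and>
             (case_A T L c es \<or> case_B T L c es \<or> case_C L c es \<or> case_D L c es)"
    and "root_label t = Clause L"
  shows "refutes_or_reaches T \<eta> (star_free_lengths t) (clause_form L)"
  using assms
proof (induction t arbitrary: L)
  case (Node a es)
  then have a: "a = Clause L" by simp
  let ?S = "star_free_lengths (Node (Clause L) es)"
  have root: "Node (Clause L) es \<in> tree_nodes (Node a es)" using a by simp
  have finL: "finite L" using Node.prems(1)[OF root] .
  show ?case
  proof (cases "es = []")
    case True
    have "T \<turnstile> (clause_form L \<Rightarrow>[0] \<eta>)"
      using Node.prems(2) root True by (intro lae_proves_taut) auto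
    then show ?thesis
      unfolding refutes_or_reaches_def star_free_lengths_def using True a by auto
  next
    case False
    obtain c where c: "\<forall>(w, t)\<in>set es. w = c"
      and cases: "case_A T L c es \<or> case_B T L c es \<or> case_C L c es \<or> case_D L c es"
      using Node.prems(3)[OF root False] by blast
    have child: "finite K \<and> (\<exists>S'. (+) c ` S' \<subseteq> ?S \<and> refutes_or_reaches T \<eta> S' (clause_form K))"
      if K: "Clause K \<in> set (child_labels es)" for K
    proof -
      obtain w t where t: "(w, t) \<in> set es" "root_label t = Clause K"
        using K by auto
      have sub: "tree_nodes t \<subseteq> tree_nodes (Node a es)" by (rule tree_nodes_child[OF t(1)])
      have "refutes_or_reaches T \<eta> (star_free_lengths t) (clause_form K)"
        using Node.prems sub t(2) by (intro Node.IH[OF t(1)]) (auto simp del: tree_nodes.simps)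
      moreover have "(+) c ` star_free_lengths t \<subseteq> ?S"
        using star_free_lengths_child[OF t(1)] c t(1) by fast
      moreover have "finite K"
        using Node.prems(1)[of K "edges t"] sub root_in_tree_nodes[of t] t(2)
        by (metis ptree.collapse subsetD)
      ultimately show ?thesis by blast
    qed
    have child0: "refutes_or_reaches T \<eta> ?S (clause_form K)"
      if "Clause K \<in> set (child_labels es)" "c = 0" for K
      using child[OF that(1)] that(2) by (auto intro: refutes_or_reaches_mono)
    have "refutes_or_reaches T \<eta> ?S (clause_form L)"
      using cases
    proof (elim disjE)
      assume "case_A T L c es"
      then obtain ls mss where c0: "c = 0" and ax: "basic_gimp ls 0 mss \<in> T" and ls: "set ls \<subseteq> L"
        and ch: "\<And>ms. ms \<in> set mss \<Longrightarrow> \<exists>K. Clause K \<in> set (child_labels es) \<and> K \<subseteq> set ms \<union> L"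
        unfolding case_A_def by blast
      let ?mu = "\<lambda>ms. big_and (map lit_form ms)"
      \<comment> \<open>A child may reuse literals of \<open>L\<close>, so
        \<open>clause_form L\<close> is kept as a side conjunct, carried through the implication by
        R2.\<close>
      let ?\<beta> = "And (big_or (map ?mu mss)) (clause_form L)"
      have "refutes_or_reaches T \<eta> ?S ?\<beta>"
      proof (rule refutes_or_reaches_cases)
        fix ms assume "ms \<in> set mss"
        then obtain K where K: "Clause K \<in> set (child_labels es)" "K \<subseteq> set ms \<union> L"
          using ch by blast
        show "refutes_or_reaches T \<eta> ?S (And (?mu ms) (clause_form L))"
          by (rule refutes_or_reaches_taut[OF _ child0[OF K(1) c0]])
            (use K child[OF K(1)] finL in \<open>auto simp: holds_clause_form\<close>)
      qed auto
      moreover have "T \<turnstile> (?mu ls \<Rightarrow>[0] big_or (map ?mu mss))"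
        using lae_proves_axiom[OF ax] by (simp add: basic_gimp_def)
      ultimately have "refutes_or_reaches T \<eta> ?S (And (?mu ls) (clause_form L))"
        using refutes_or_reaches_trans0[OF lae_proves_And] by blast
      then show ?thesis
        by (rule refutes_or_reaches_taut[rotated]) (use finL ls in \<open>auto simp: holds_clause_form\<close>)
    next
      assume "case_B T L c es"
      then obtain ls mss where c0: "c > 0" and ax: "basic_gimp ls c mss \<in> T" and ls: "set ls \<subseteq> L"
        and ch: "\<And>ms. ms \<in> set mss \<Longrightarrow> \<exists>K. Clause K \<in> set (child_labels es) \<and> K \<subseteq> set ms"
        unfolding case_B_def by blast
      let ?mu = "\<lambda>ms. big_and (map lit_form ms)"
      \<comment> \<open>Here children use only literals of the right-hand side, so no side conjunct
        is kept; R2 would not allow one at positive degree. The preimage of \<open>?S\<close> under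
        adding \<open>c\<close> is a single set of degrees suitable for all children.\<close>
      let ?S' = "{s. c + s \<in> ?S}"
      have "refutes_or_reaches T \<eta> ?S' (big_or (map ?mu mss))"
      proof (rule refutes_or_reaches_cases)
        fix ms assume "ms \<in> set mss"
        then obtain K where K: "Clause K \<in> set (child_labels es)" "K \<subseteq> set ms"
          using ch by blast
        then have "refutes_or_reaches T \<eta> ?S' (clause_form K)"
          using child[OF K(1)] by (auto intro: refutes_or_reaches_mono)
        then show "refutes_or_reaches T \<eta> ?S' (?mu ms)"
          by (rule refutes_or_reaches_taut[rotated])
            (use K child[OF K(1)] in \<open>auto simp: holds_clause_form\<close>)
      qed auto
      moreover have "T \<turnstile> (?mu ls \<Rightarrow>[c] big_or (map ?mu mss))"
        using lae_proves_axiom[OF ax] by (simp add: basic_gimp_def)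
      ultimately have "refutes_or_reaches T \<eta> ((+) c ` ?S') (?mu ls)"
        using c0 by (intro refutes_or_reaches_trans) auto
      then have "refutes_or_reaches T \<eta> ?S (?mu ls)"
        by (rule refutes_or_reaches_mono) auto
      then show ?thesis
        by (rule refutes_or_reaches_taut[rotated]) (use finL ls in \<open>auto simp: holds_clause_form\<close>)
    next
      \<comment> \<open>The clause is contradictory by itself, so nothing is taken from the star
        below it.\<close>
      assume "case_C L c es"
      then obtain p where "PosL p \<in> L" "NegL p \<in> L"
        unfolding case_C_def inconsistent_def by blast
      then have "T \<turnstile> (clause_form L \<Rightarrow>[0] Bot)"
        using finL by (intro lae_proves_taut)
          (metis holds_clause_form holds.simps(6) lit_form.simps)
      then show ?thesis by (simp add: refutes_or_reaches_def)
    next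
      assume "case_D L c es"
      then obtain p S1 S2 where c0: "c = 0" and S: "S1 \<subseteq> L" "S2 \<subseteq> L"
        and K: "Clause (insert (PosL p) S1) \<in> set (child_labels es)"
          "Clause (insert (NegL p) S2) \<in> set (child_labels es)"
        unfolding case_D_def by (metis list.set_intros)
      have "refutes_or_reaches T \<eta> ?S
          (Or (clause_form (insert (PosL p) S1)) (clause_form (insert (NegL p) S2)))"
        using child0[OF _ c0] K by (intro refutes_or_reaches_Or)
      \<comment> \<open>Excluded middle for \<open>p\<close>: a valuation satisfying
        \<open>L\<close> satisfies one of the two children, whose other literals come from
        \<open>L\<close>.\<close>
      then show ?thesis
        by (rule refutes_or_reaches_taut[rotated])
          (use S finL finite_subset[OF S(1)] finite_subset[OF S(2)]
            in \<open>auto simp: holds_clause_form\<close>)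
    qed
    then show ?thesis using a by simp
  qed
qed

section \<open>From single trees to the whole forest\<close>

lemma star_free_lengths_le_forest_length:
  assumes "t \<in> set F" "s \<in> star_free_lengths t"
  shows "s \<le> forest_length F"
proof -
  obtain as ws where b: "(as, ws) \<in> set (tree_branches t)" "Star \<notin> set as" "s = sum_list ws"
    using assms(2) by (auto simp: star_free_lengths_def)
  then have "s = branch_length (as, ws)" by (simp add: branch_length_def)
  then have "s \<in> insert 0 (branch_length ` (\<Union>t\<in>set F. set (tree_branches t)))"
    using assms(1) b(1) by blast
  then show ?thesis unfolding forest_length_def by (intro Max_ge) auto
qed

theorem theorem3p7:
  fixes T :: "gimp set" and \<zeta> \<eta> :: form and r :: real
  assumes "basic_theory T"
    and "0 \<le> r"
    and "\<exists>F. forest_proof T \<zeta> r \<eta> F"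
  shows "T \<turnstile> (\<zeta> \<Rightarrow>[r] \<eta>)"
proof -
  obtain F where F: "forest_proof T \<zeta> r \<eta> F" using assms(3) ..
  then have forest: "proof_forest F" and len: "forest_length F \<le> r"
    unfolding forest_proof_def by simp_all
  obtain B where B: "clause_set_for B \<zeta>" "\<And>L. L \<in> B \<Longrightarrow> \<exists>K. Clause K \<in> root_label ` set F \<and> K \<subseteq> L"
    using F unfolding forest_proof_def by (elim conjE exE) auto
  obtain C where C: "clause_set_for C \<eta>"
      "\<And>L. Node (Clause L) [] \<in> forest_nodes F \<Longrightarrow> \<exists>K\<in>C. K \<subseteq> L"
    using F unfolding forest_proof_def by (elim conjE exE) auto
  have step: "\<And>L es. Node (Clause L) es \<in> forest_nodes F \<Longrightarrow> es \<noteq> [] \<Longrightarrow>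
        \<exists>c. (\<forall>(w, t)\<in>set es. w = c) \<and>
             (case_A T L c es \<or> case_B T L c es \<or> case_C L c es \<or> case_D L c es)"
    using F unfolding forest_proof_def by simp
  have fin: "finite L" if "Node (Clause L) es \<in> forest_nodes F" for L es
    using forest that unfolding proof_forest_def is_clause_def by blast
  have finB: "finite B" "\<And>L. L \<in> B \<Longrightarrow> finite L" and finC: "finite C" "\<And>L. L \<in> C \<Longrightarrow> finite L"
    using B(1) C(1) by (auto simp: clause_set_for_def is_clause_set_def is_clause_def)
  have \<zeta>: "\<exists>L\<in>B. holds v (clause_form L)" if "holds v \<zeta>" for v
    using B(1) that finB(1)
    by (auto simp: clause_set_for_def bool_equiv_def tautology_def holds_clause_set_form)
  have \<eta>: "holds v \<eta>" if "K \<in> C" "holds v (clause_form K)" for v K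
    using C(1) that finC(1)
    by (auto simp: clause_set_for_def bool_equiv_def tautology_def holds_clause_set_form)
  \<comment> \<open>A larger clause is a stronger conjunction, so (T2) makes every terminal clause
    imply \<open>\<eta>\<close> classically.\<close>
  have leaf: "holds v \<eta>" if L: "Node (Clause L) [] \<in> forest_nodes F" "holds v (clause_form L)" for L v
  proof -
    obtain K where "K \<in> C" "K \<subseteq> L" using C(2) L(1) by blast
    then show ?thesis
      using \<eta>[of K v] L(2) fin[OF L(1)] finC(2) by (auto simp: holds_clause_form)
  qed
  \<comment> \<open>The cases are the clauses of \<open>B\<close>; by (T1) each one implies the root
    clause contained in it.\<close>
  have "refutes_or_reaches T \<eta> {..r} \<zeta>"
  proof (rule refutes_or_reaches_cases)
    fix L assume "L \<in> set (enum_list B)"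
    then have L: "L \<in> B" using finB by simp
    obtain t K where t: "t \<in> set F" "root_label t = Clause K" and K: "K \<subseteq> L"
      using B(2)[OF L] by (metis imageE)
    have sub: "tree_nodes t \<subseteq> forest_nodes F" using t(1) by (auto simp: forest_nodes_def)
    have "refutes_or_reaches T \<eta> (star_free_lengths t) (clause_form K)"
      using fin leaf step sub t(2) by (intro tree_refutes_or_reaches) blast+
    moreover have "star_free_lengths t \<subseteq> {..r}"
      using star_free_lengths_le_forest_length[OF t(1)] len by force
    ultimately have "refutes_or_reaches T \<eta> {..r} (clause_form K)"
      by (rule refutes_or_reaches_mono)
    then show "refutes_or_reaches T \<eta> {..r} (clause_form L)"
      by (rule refutes_or_reaches_taut[rotated])
        (use K finB(2)[OF L] finite_subset[OF K] in \<open>auto simp: holds_clause_form\<close>)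
  qed (use \<zeta> finB in auto)
  \<comment> \<open>A refuted \<open>\<zeta>\<close> implies everything at degree \<open>r\<close>,
    as \<open>0 \<le> r\<close>; otherwise the degree reached is at most \<open>r\<close> and is
    weakened to it.\<close>
  then show ?thesis
    unfolding refutes_or_reaches_def
    using lae_proves_Bot_imp[OF _ assms(2)] lae_proves_weaken by blast
qed

end
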